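(* Let $k$ be a field with algebraic closure $\overline{k}$, let $f(x)\in k[x]$, and assume that $f(0)\neq 0$. Assume that $f$ satisfies at least one of the following criteria: (i) $f$ is separable (i.e. $f$ has no repeated roots in $\overline{k}$); (ii) $f=gh$ for some coprime $g,h\in k[x]$ each satisfying the inversion criterion (defined in the context). Then $\operatorname{tol}(f)=\operatorname{tol}(f^* )$.
   Context: Let $k$ be a field with algebraic closure $\overline{k}$, and let $f=a_nx^n+\ldots+a_0\in k[x]$ with $a_n\neq 0$. Write $f=a_n\prod_{i=1}^s(x-r_i)^{m_i}$ over $\overline{k}$, where $r_1,\ldots,r_s$ are distinct and $m_i\geq 1$. The tolerant of $f$ is $\operatorname{tol}(f):=a_n^{2n-2}\prod_{1\leq i<j\leq s}(r_i-r_j)^{2m_im_j}$. If $f(0)\neq 0$, the reciprocal of $f$ is $f^*(x)=x^{\deg(f)}\cdot f(\tfrac{1}{x})$. Inversion criterion: a polynomial $q(x)=q_Nx^N+\ldots+q_0\in k[x]$ with $q_N,q_0\neq 0$, whose distinct roots in $\overline{k}$ are $t_1,\ldots,t_c$ with multiplicities $\mu_1,\ldots,\mu_c$, satisfies the inversion criterion if $$\prod_{1\leq i<j\leq c}(t_it_j)^{2\mu_i\mu_j}=\left(\frac{q_0}{q_N}\right)^{2N-2}.$$ (If $f=gh$ with $f(0)\neq 0$, then $g(0)\neq 0$ and $h(0)\neq 0$ automatically.) *)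

theory Defs
  imports "HOL-Algebra.Algebraic_Closure_Type"
begin

abbreviation ac_poly :: "'a::field poly \<Rightarrow> 'a alg_closure poly"
  where "ac_poly p \<equiv> map_poly to_ac p"

abbreviation ac_mult :: "'a::field poly \<Rightarrow> 'a alg_closure \<Rightarrow> nat"
  where "ac_mult p r \<equiv> Polynomial.order r (ac_poly p)"

text \<open>
  An arbitrary enumeration, without repetition, of the roots in the algebraic closure.
  It exists for every nonzero polynomial. The products below do not depend on the choice:
  see \<open>tol_eq\<close> and \<open>inversion_criterion_iff\<close>.
\<close>
definition ac_roots :: "'a::field poly \<Rightarrow> 'a alg_closure list"
  where "ac_roots p = (SOME rs. distinct rs \<and> set rs = {r. poly (ac_poly p) r = 0})"

text \<open>
  The exponent of the leading coefficient is an integer power, since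
  \<open>2 * n - 2\<close> is negative for constant polynomials. The value is taken in the
  algebraic closure.
\<close>
definition tol :: "'a::field poly \<Rightarrow> 'a alg_closure"
  where "tol f =
    to_ac (Polynomial.lead_coeff f) powi (2 * int (Polynomial.degree f) - 2) *
    (let rs = ac_roots f in
      \<Prod>(i, j) \<in> {(i, j). i < j \<and> j < length rs}.
        (rs ! i - rs ! j) ^ (2 * ac_mult f (rs ! i) * ac_mult f (rs ! j)))"

text \<open>
  \<open>poly.coeff q 0 \<noteq> 0\<close> entails that \<open>q \<noteq> 0\<close>, so that the leading coefficient is nonzero.
\<close>
definition inversion_criterion :: "'a::field poly \<Rightarrow> bool"
  where "inversion_criterion q \<longleftrightarrow>
    poly.coeff q 0 \<noteq> 0 \<and>
    (let ts = ac_roots q in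
      \<Prod>(i, j) \<in> {(i, j). i < j \<and> j < length ts}.
        (ts ! i * ts ! j) ^ (2 * ac_mult q (ts ! i) * ac_mult q (ts ! j)))
    = to_ac (poly.coeff q 0 / Polynomial.lead_coeff q) powi (2 * int (Polynomial.degree q) - 2)"

lemma ac_roots:
  assumes "p \<noteq> 0"
  shows "distinct (ac_roots p)" "set (ac_roots p) = {r. poly (ac_poly p) r = 0}"
proof -
  have "ac_poly p \<noteq> 0"
    using assms by (auto simp: poly_eq_iff coeff_map_poly)
  hence "finite {r. poly (ac_poly p) r = 0}" by (rule poly_roots_finite)
  hence "\<exists>rs. distinct rs \<and> set rs = {r. poly (ac_poly p) r = 0}"
    using finite_distinct_list by blast
  hence "distinct (ac_roots p) \<and> set (ac_roots p) = {r. poly (ac_poly p) r = 0}"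
    unfolding ac_roots_def by (rule someI_ex)
  thus "distinct (ac_roots p)" "set (ac_roots p) = {r. poly (ac_poly p) r = 0}" by auto
qed

lemma prod_pairs_eq_prod_subsets:
  fixes F :: "'b \<Rightarrow> 'b \<Rightarrow> 'c::comm_monoid_mult"
  assumes sym: "\<And>x y. F x y = F y x" and dist: "distinct xs"
  shows "(\<Prod>(i, j) \<in> {(i, j). i < j \<and> j < length xs}. F (xs ! i) (xs ! j)) =
    (\<Prod>S \<in> {S. S \<subseteq> set xs \<and> card S = 2}. THE z. \<exists>x y. S = {x, y} \<and> z = F x y)"
proof -
  let ?h = "\<lambda>(i, j). {xs ! i, xs ! j}"
  let ?P = "{(i, j). i < j \<and> j < length xs}"
  have bij: "bij_betw ?h ?P {S. S \<subseteq> set xs \<and> card S = 2}"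
  proof (rule bij_betwI')
    fix p q assume "p \<in> ?P" "q \<in> ?P"
    thus "(?h p = ?h q) = (p = q)"
      using dist by (auto simp: doubleton_eq_iff nth_eq_iff_index_eq)
  next
    fix p assume "p \<in> ?P"
    thus "?h p \<in> {S. S \<subseteq> set xs \<and> card S = 2}"
      using dist by (auto simp: card_insert_if nth_eq_iff_index_eq)
  next
    fix S assume "S \<in> {S. S \<subseteq> set xs \<and> card S = 2}"
    then obtain x y where xy: "S = {x, y}" "x \<noteq> y" "x \<in> set xs" "y \<in> set xs"
      by (auto simp: card_2_iff)
    then obtain i j where ij: "i < length xs" "j < length xs" "xs ! i = x" "xs ! j = y"
      by (metis in_set_conv_nth)
    with xy have "i \<noteq> j" by auto
    hence "i < j \<or> j < i" by linarith
    thus "\<exists>p\<in>?P. S = ?h p"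
    proof
      assume "i < j"
      with ij xy show ?thesis by (intro bexI[of _ "(i, j)"]) auto
    next
      assume "j < i"
      with ij xy show ?thesis by (intro bexI[of _ "(j, i)"]) auto
    qed
  qed
  have "(THE z. \<exists>x y. {a, b} = {x, y} \<and> z = F x y) = F a b" for a b
    by (rule the_equality) (auto simp: doubleton_eq_iff intro: sym)
  hence "(\<Prod>p\<in>?P. THE z. \<exists>x y. ?h p = {x, y} \<and> z = F x y) =
      (\<Prod>(i, j)\<in>?P. F (xs ! i) (xs ! j))"
    by (intro prod.cong) auto
  thus ?thesis
    using prod.reindex_bij_betw[OF bij, of "\<lambda>S. THE z. \<exists>x y. S = {x, y} \<and> z = F x y"]
    by (simp only:)
qed

lemma prod_pairs_cong:
  fixes F :: "'b \<Rightarrow> 'b \<Rightarrow> 'c::comm_monoid_mult"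
  assumes "\<And>x y. F x y = F y x" "distinct xs" "distinct ys" "set xs = set ys"
  shows "(\<Prod>(i, j) \<in> {(i, j). i < j \<and> j < length xs}. F (xs ! i) (xs ! j)) =
    (\<Prod>(i, j) \<in> {(i, j). i < j \<and> j < length ys}. F (ys ! i) (ys ! j))"
  using assms by (simp add: prod_pairs_eq_prod_subsets)

lemma tol_eq:
  assumes "f \<noteq> 0" "distinct rs" "set rs = {r. poly (ac_poly f) r = 0}"
  shows "tol f =
    to_ac (Polynomial.lead_coeff f) powi (2 * int (Polynomial.degree f) - 2) *
    (\<Prod>(i, j) \<in> {(i, j). i < j \<and> j < length rs}.
      (rs ! i - rs ! j) ^ (2 * ac_mult f (rs ! i) * ac_mult f (rs ! j)))"
proof -
  have "(x - y) ^ (2 * ac_mult f x * ac_mult f y) = (y - x) ^ (2 * ac_mult f y * ac_mult f x)"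
    for x y
  proof -
    have "(x - y) ^ (2 * m * n) = (y - x) ^ (2 * n * m)" for m n
    proof -
      have "(x - y) ^ (2 * m * n) = ((x - y)\<^sup>2) ^ (m * n)"
        by (simp only: power_mult)
      also have "\<dots> = ((y - x)\<^sup>2) ^ (n * m)"
        by (simp only: power2_commute[of x y] mult.commute[of m n])
      also have "\<dots> = (y - x) ^ (2 * n * m)"
        by (simp only: power_mult)
      finally show ?thesis .
    qed
    thus ?thesis .
  qed
  from prod_pairs_cong[of "\<lambda>x y. (x - y) ^ (2 * ac_mult f x * ac_mult f y)",
      OF this ac_roots(1)[OF assms(1)] assms(2)] ac_roots(2)[OF assms(1)] assms(3)
  show ?thesis by (simp add: tol_def Let_def)
qed

lemma inversion_criterion_iff:
  assumes "q \<noteq> 0" "distinct ts" "set ts = {t. poly (ac_poly q) t = 0}"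
  shows "inversion_criterion q \<longleftrightarrow>
    poly.coeff q 0 \<noteq> 0 \<and>
    (\<Prod>(i, j) \<in> {(i, j). i < j \<and> j < length ts}.
      (ts ! i * ts ! j) ^ (2 * ac_mult q (ts ! i) * ac_mult q (ts ! j)))
    = to_ac (poly.coeff q 0 / Polynomial.lead_coeff q) powi (2 * int (Polynomial.degree q) - 2)"
proof -
  have "(x * y) ^ (2 * ac_mult q x * ac_mult q y) = (y * x) ^ (2 * ac_mult q y * ac_mult q x)"
    for x y
    by (simp add: mult_ac)
  from prod_pairs_cong[of "\<lambda>x y. (x * y) ^ (2 * ac_mult q x * ac_mult q y)",
      OF this ac_roots(1)[OF assms(1)] assms(2)] ac_roots(2)[OF assms(1)] assms(3)
  show ?thesis by (simp add: inversion_criterion_def Let_def)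
qed

text \<open>
  The library's \<^const>\<open>reflect_poly\<close> is the reciprocal \<open>x\<^sup>n f(1/x)\<close>. As the algebraic
  closure is infinite, the following identity determines it.
\<close>
lemma poly_ac_poly_reflect_poly:
  assumes "x \<noteq> 0"
  shows "poly (ac_poly (reflect_poly f)) x =
    x ^ Polynomial.degree f * poly (ac_poly f) (1 / x)"
proof -
  have deg: "Polynomial.degree (ac_poly f) = Polynomial.degree f"
    by (rule degree_map_poly) auto
  have "ac_poly (reflect_poly f) = reflect_poly (ac_poly f)"
    by (rule poly_eqI) (simp add: coeff_reflect_poly coeff_map_poly deg)
  with assms show ?thesis by (simp add: poly_reflect_poly_nz deg inverse_eq_divide)
qed

end

theory Submission
  imports Defs
begin

text \<open>
  Write the roots of \<open>f\<close> as \<open>r\<^sub>i\<close> with multiplicities \<open>m\<^sub>i\<close>, and \<open>n = deg f\<close>. Reciprocation inverts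
  the roots, keeps their multiplicities and exchanges the two extreme coefficients. Since
  \<open>1/r\<^sub>i - 1/r\<^sub>j = - (r\<^sub>i - r\<^sub>j) / (r\<^sub>i r\<^sub>j)\<close> and all exponents are even, the two tolerants differ by the
  quotient of the two sides of the inversion criterion for \<open>f\<close>. So it suffices that \<open>f\<close> itself
  satisfies the criterion (\<open>tol_reflect_poly_if_inversion_criterion\<close>).

  The criterion has a form that involves each root on its own. In the product over pairs, \<open>r\<^sub>i\<close> occurs
  with exponent \<open>2 m\<^sub>i (n - m\<^sub>i)\<close>, while by Vieta \<open>(a\<^sub>0/a\<^sub>n)\<^sup>2\<close> is the product of the \<open>r\<^sub>i\<close> to the powers
  \<open>2 m\<^sub>i\<close>. Comparing the two, the criterion says that the product of the \<open>r\<^sub>i\<close> to the powers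
  \<open>2 m\<^sub>i\<^sup>2\<close> equals the product of the \<open>r\<^sub>i\<close> to the powers \<open>2 m\<^sub>i\<close>
  (\<open>inversion_criterion_iff_prod_roots\<close>). If all \<open>m\<^sub>i = 1\<close>, this is trivial. If \<open>f = g h\<close> with \<open>g\<close>, \<open>h\<close>
  coprime, the roots of \<open>f\<close> are the disjoint union of those of \<open>g\<close> and \<open>h\<close>, with the same
  multiplicities, so both products are multiplicative and the criterion passes from \<open>g\<close> and \<open>h\<close>
  to \<open>f\<close>.
\<close>

section \<open>Products over pairs of indices\<close>

lemma prod_square_split:
  fixes g :: "nat \<Rightarrow> nat \<Rightarrow> 'b::comm_monoid_mult"
  shows "(\<Prod>i<n. \<Prod>j<n. g i j) =
    (\<Prod>(i, j) \<in> {(i, j). i < j \<and> j < n}. g i j * g j i) * (\<Prod>i<n. g i i)"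
proof (induction n)
  case 0
  show ?case by simp
next
  case (Suc n)
  have fin: "finite {(i, j). i < j \<and> j < n}"
    by (rule finite_subset[of _ "{..<n} \<times> {..<n}"]) auto
  have "{(i, j). i < j \<and> j < Suc n} = {(i, j). i < j \<and> j < n} \<union> (\<lambda>i. (i, n)) ` {..<n}"
    by (auto simp: less_Suc_eq)
  hence "(\<Prod>(i, j) \<in> {(i, j). i < j \<and> j < Suc n}. g i j * g j i) =
      (\<Prod>(i, j) \<in> {(i, j). i < j \<and> j < n}. g i j * g j i) *
      (\<Prod>(i, j) \<in> (\<lambda>i. (i, n)) ` {..<n}. g i j * g j i)"
    using fin by (simp only:) (rule prod.union_disjoint; auto)
  also have "(\<Prod>(i, j) \<in> (\<lambda>i. (i, n)) ` {..<n}. g i j * g j i) = (\<Prod>i<n. g i n * g n i)"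
    by (subst prod.reindex) (auto simp: inj_on_def)
  finally show ?case
    using Suc by (simp add: prod.distrib mult_ac)
qed

text \<open>
  Apply the splitting of a square of indices to \<open>x\<^sub>i\<close> to the power \<open>2 m\<^sub>i m\<^sub>j\<close>: the full square
  factors, and the factors at \<open>(i, j)\<close> and \<open>(j, i)\<close> combine to a power of \<open>x\<^sub>i x\<^sub>j\<close>.
\<close>
lemma prod_pairs_mult_power:
  fixes xs :: "'b::comm_semiring_1 list" and m :: "'b \<Rightarrow> nat"
  assumes "distinct xs"
  shows "(\<Prod>(i, j) \<in> {(i, j). i < j \<and> j < length xs}.
        (xs ! i * xs ! j) ^ (2 * m (xs ! i) * m (xs ! j))) *
      (\<Prod>x\<in>set xs. x ^ (2 * (m x)\<^sup>2)) =
    (\<Prod>x\<in>set xs. x ^ (2 * m x)) ^ (\<Sum>x\<in>set xs. m x)"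
proof -
  let ?n = "length xs"
  have bij: "bij_betw ((!) xs) {..<?n} (set xs)"
    using assms by (rule bij_betw_nth) auto
  have idx: "(\<Prod>i<?n. h (xs ! i)) = (\<Prod>x\<in>set xs. h x)" for h :: "'b \<Rightarrow> 'b"
    using bij by (rule prod.reindex_bij_betw)
  have idx_sum: "(\<Sum>i<?n. m (xs ! i)) = (\<Sum>x\<in>set xs. m x)"
    using bij by (rule sum.reindex_bij_betw)
  have "(\<Prod>i<?n. \<Prod>j<?n. (xs ! i) ^ (2 * m (xs ! i) * m (xs ! j))) =
      (\<Prod>i<?n. ((xs ! i) ^ (2 * m (xs ! i))) ^ (\<Sum>j<?n. m (xs ! j)))"
    by (simp add: power_mult power_sum)
  also have "\<dots> = (\<Prod>x\<in>set xs. x ^ (2 * m x)) ^ (\<Sum>x\<in>set xs. m x)"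
    unfolding idx_sum
    using idx[of "\<lambda>x. (x ^ (2 * m x)) ^ (\<Sum>x\<in>set xs. m x)"]
    by (simp only: prod_power_distrib)
  also have "(\<Prod>i<?n. \<Prod>j<?n. (xs ! i) ^ (2 * m (xs ! i) * m (xs ! j))) =
      (\<Prod>(i, j) \<in> {(i, j). i < j \<and> j < ?n}.
        (xs ! i * xs ! j) ^ (2 * m (xs ! i) * m (xs ! j))) *
      (\<Prod>i<?n. (xs ! i) ^ (2 * (m (xs ! i))\<^sup>2))"
    by (subst prod_square_split) (simp add: power_mult_distrib power2_eq_square mult_ac)
  finally show ?thesis
    using idx[of "\<lambda>x. x ^ (2 * (m x)\<^sup>2)"] by simp
qed

section \<open>Roots of polynomials\<close>

lemma alg_closed_sum_order_eq_degree:
  fixes p :: "'b::alg_closed_field poly"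
  assumes "p \<noteq> 0"
  shows "(\<Sum>r | poly p r = 0. Polynomial.order r p) = Polynomial.degree p"
  and alg_closed_prod_roots:
    "(\<Prod>r | poly p r = 0. r ^ Polynomial.order r p) =
      (-1) ^ Polynomial.degree p * (poly.coeff p 0 / Polynomial.lead_coeff p)"
proof -
  obtain A where A: "size A = Polynomial.degree p"
      "p = smult (Polynomial.lead_coeff p) (\<Prod>x\<in>#A. [:-x, 1:])"
    using alg_closed_imp_factorization[OF assms] by blast
  have lc: "Polynomial.lead_coeff p \<noteq> 0" using assms by simp
  have "proots (\<Prod>x\<in>#A. [:-x, 1:]) = A"
  proof (induction A)
    case (add x A)
    have "(\<Prod>x\<in>#A. [:-x, 1:]) \<noteq> 0"
      by auto
    hence "proots ([:-x, 1:] * (\<Prod>x\<in>#A. [:-x, 1:])) = {#x#} + A"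
      using add.IH by (subst proots_mult) (auto simp del: mult_pCons_left)
    thus ?case by simp
  qed simp
  hence roots: "proots p = A"
    using A(2) lc by (metis proots_smult)
  show "(\<Sum>r | poly p r = 0. Polynomial.order r p) = Polynomial.degree p"
    using A(1) assms unfolding roots[symmetric] size_multiset_overloaded_eq by simp
  have "(\<Prod>x\<in>#B. poly [:-x, 1:] 0) = (-1) ^ size B * (\<Prod>x\<in>#B. x)" for B :: "'b multiset"
    by (induction B) simp_all
  moreover have "poly.coeff p 0 =
      Polynomial.lead_coeff p * (\<Prod>x\<in>#A. poly [:-x, 1:] 0)"
    by (subst A(2)) (simp add: poly_0_coeff_0[symmetric] poly_prod_mset image_mset.compositionality o_def)
  ultimately have "poly.coeff p 0 / Polynomial.lead_coeff p =
      (-1) ^ Polynomial.degree p * (\<Prod>x\<in>#A. x)"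
    using lc A(1) by simp
  moreover have "(\<Prod>x\<in>#A. x) = (\<Prod>r | poly p r = 0. r ^ Polynomial.order r p)"
    using roots assms by (subst image_prod_mset_multiplicity) auto
  ultimately show "(\<Prod>r | poly p r = 0. r ^ Polynomial.order r p) =
      (-1) ^ Polynomial.degree p * (poly.coeff p 0 / Polynomial.lead_coeff p)"
    by (simp flip: mult.assoc power_add mult_2)
qed

text \<open>
  Split off the full power of \<open>x - r\<close>: reciprocation turns it into an associate of the same power of
  \<open>x - 1/r\<close>, and the cofactor still does not vanish there.
\<close>
lemma order_reflect_poly:
  fixes p :: "'b::field poly"
  assumes "p \<noteq> 0" "r \<noteq> 0"
  shows "Polynomial.order (inverse r) (reflect_poly p) = Polynomial.order r p"
proof -
  define k where "k = Polynomial.order r p"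
  obtain q where q: "p = [:-r, 1:] ^ k * q" "\<not> [:-r, 1:] dvd q"
    using order_decomp[OF assms(1), of r] k_def by blast
  have qr: "poly q r \<noteq> 0" using q(2) by (simp add: poly_eq_0_iff_dvd)
  have "reflect_poly [:-r, 1:] = smult (-r) [:- inverse r, 1:]"
    using assms(2) by (simp add: reflect_poly_pCons' monom_Suc monom_0)
  hence "reflect_poly p = smult ((-r) ^ k) ([:- inverse r, 1:] ^ k * reflect_poly q)"
    by (simp only: q(1) reflect_poly_mult reflect_poly_power smult_power
        mult_smult_left)
  moreover have "poly (reflect_poly q) (inverse r) \<noteq> 0"
    using qr assms(2) by (simp add: poly_reflect_poly_nz)
  moreover from this have "reflect_poly q \<noteq> 0" by auto
  ultimately show ?thesis
    using assms(2)
    by (simp add: order_smult order_mult order_power_n_n order_0I k_def)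
qed

lemma roots_reflect_poly:
  fixes p :: "'b::field poly"
  assumes "poly.coeff p 0 \<noteq> 0"
  shows "{r. poly (reflect_poly p) r = 0} = inverse ` {r. poly p r = 0}"
proof -
  have "poly p 0 \<noteq> 0" "poly (reflect_poly p) 0 \<noteq> 0"
    using assms by (auto simp: poly_0_coeff_0)
  hence "poly (reflect_poly p) r = 0 \<longleftrightarrow> poly p (inverse r) = 0" for r
    by (cases "r = 0") (auto simp: poly_reflect_poly_nz)
  thus ?thesis
    by (force intro: image_eqI[where x = "inverse r" for r])
qed

lemma ac_poly_eq_0_iff [simp]: "ac_poly p = 0 \<longleftrightarrow> p = 0"
  by (auto simp: poly_eq_iff coeff_map_poly)

lemma degree_ac_poly [simp]: "Polynomial.degree (ac_poly p) = Polynomial.degree p"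
  by (rule degree_map_poly) auto

lemma ac_poly_add: "ac_poly (p + q) = ac_poly p + ac_poly q"
  by (rule poly_eqI) (simp add: coeff_map_poly)

lemma ac_poly_mult: "ac_poly (p * q) = ac_poly p * ac_poly q"
  by (rule poly_eqI) (simp add: coeff_map_poly coeff_mult to_ac_sum)

lemma ac_poly_reflect_poly: "ac_poly (reflect_poly p) = reflect_poly (ac_poly p)"
  by (rule poly_eqI) (simp add: coeff_reflect_poly coeff_map_poly)

lemma nonzero_if_ac_root:
  assumes "poly.coeff p 0 \<noteq> 0" "poly (ac_poly p) r = 0"
  shows "r \<noteq> 0"
  using assms by (auto simp: poly_0_coeff_0 coeff_map_poly)

text \<open>
  A common root in the closure would make its minimal polynomial over the base field a common divisor.
\<close>
lemma coprime_no_common_ac_root: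
  fixes p q :: "'a::field poly"
  assumes "coprime p q" "poly (ac_poly p) r = 0"
  shows "poly (ac_poly q) r \<noteq> 0"
proof
  assume qr: "poly (ac_poly q) r = 0"
  let ?V = "\<lambda>d. d \<noteq> 0 \<and> poly (ac_poly d) r = 0"
  have "p \<noteq> 0 \<or> q \<noteq> 0"
    using assms(1) by auto
  hence "\<exists>d. ?V d"
    using assms(2) qr by blast
  then obtain d where d: "d \<noteq> 0" "poly (ac_poly d) r = 0"
      and min: "\<And>e. ?V e \<Longrightarrow> Polynomial.degree d \<le> Polynomial.degree e"
    using ex_has_least_nat[of ?V _ Polynomial.degree] by blast
  \<comment> \<open>The remainder of \<open>e\<close> modulo \<open>d\<close> vanishes at \<open>r\<close> too, so it is zero by minimality.\<close>
  have dvd: "d dvd e" if "poly (ac_poly e) r = 0" for e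
  proof -
    have "ac_poly e = ac_poly (e div d) * ac_poly d + ac_poly (e mod d)"
      by (simp flip: ac_poly_add ac_poly_mult)
    hence "poly (ac_poly (e mod d)) r = 0"
      using that d(2) by simp
    hence "e mod d = 0"
      using min[of "e mod d"] degree_mod_less[OF d(1), of e] by (meson not_less)
    thus ?thesis by (rule dvd_eq_mod_eq_0[THEN iffD2])
  qed
  have "is_unit d"
    using assms(1) dvd[OF assms(2)] dvd[OF qr] by (rule coprime_common_divisor)
  then obtain c where "d = [:c:]"
    by (auto elim: is_unit_polyE)
  with d show False
    by (simp add: map_poly_pCons)
qed

section \<open>The inversion criterion root by root\<close>

text \<open>
  Put \<open>c = (q\<^sub>0/q\<^sub>N)\<^sup>2\<close>, which by Vieta is the product on the right. The product over pairs times the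
  product on the left is \<open>c\<^sup>N\<close>, and the criterion says that the product over pairs times \<open>c\<close> is \<open>c\<^sup>N\<close>.
\<close>
lemma inversion_criterion_iff_prod_roots:
  fixes q :: "'a::field poly"
  assumes q0: "poly.coeff q 0 \<noteq> 0"
  shows "inversion_criterion q \<longleftrightarrow>
    (\<Prod>r | poly (ac_poly q) r = 0. r ^ (2 * (ac_mult q r)\<^sup>2)) =
    (\<Prod>r | poly (ac_poly q) r = 0. r ^ (2 * ac_mult q r))"
proof -
  have "q \<noteq> 0" using q0 by auto
  define ts where "ts = ac_roots q"
  define R where "R = {r. poly (ac_poly q) r = 0}"
  define N where "N = Polynomial.degree q"
  define e where "e = to_ac (poly.coeff q 0 / Polynomial.lead_coeff q)"
  define P where "P = (\<Prod>(i, j) \<in> {(i, j). i < j \<and> j < length ts}.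
      (ts ! i * ts ! j) ^ (2 * ac_mult q (ts ! i) * ac_mult q (ts ! j)))"
  define D where "D = (\<Prod>r\<in>R. r ^ (2 * (ac_mult q r)\<^sup>2))"
  note ts = ac_roots[OF \<open>q \<noteq> 0\<close>, folded ts_def]
  have e0: "e \<noteq> 0" using q0 \<open>q \<noteq> 0\<close> by (simp add: e_def)
  have "(\<Prod>r\<in>R. r ^ ac_mult q r) = (-1) ^ N * e"
    using alg_closed_prod_roots[of "ac_poly q"] \<open>q \<noteq> 0\<close>
    by (simp add: R_def N_def e_def coeff_map_poly)
  hence "(\<Prod>r\<in>R. r ^ ac_mult q r)\<^sup>2 = e\<^sup>2"
    by (simp add: power_mult_distrib flip: power_mult)
  moreover have "(\<Prod>r\<in>R. r ^ ac_mult q r)\<^sup>2 = (\<Prod>r\<in>R. r ^ (2 * ac_mult q r))"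
    by (simp add: prod_power_distrib mult.commute flip: power_mult)
  \<comment> \<open>Squaring removes the sign in Vieta's formula.\<close>
  ultimately have vieta: "(\<Prod>r\<in>R. r ^ (2 * ac_mult q r)) = e\<^sup>2" by simp
  have "P * D = (e\<^sup>2) ^ N"
    using prod_pairs_mult_power[OF ts(1), of "ac_mult q"] vieta
      alg_closed_sum_order_eq_degree[of "ac_poly q"] \<open>q \<noteq> 0\<close>
    by (simp add: P_def D_def ts(2) R_def N_def)
  \<comment> \<open>An integer power keeps this valid for constant polynomials, where the exponent is \<open>-2\<close>.\<close>
  also have "(e\<^sup>2) ^ N = e powi (2 * int N - 2) * e\<^sup>2"
    using e0 by (simp add: power_int_diff power_int_mult)
  finally have PD: "P * D = e powi (2 * int N - 2) * e\<^sup>2" .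
  have "inversion_criterion q \<longleftrightarrow> P = e powi (2 * int N - 2)"
    using inversion_criterion_iff[OF \<open>q \<noteq> 0\<close> ts] q0 by (simp add: P_def e_def N_def)
  also have "\<dots> \<longleftrightarrow> D = e\<^sup>2"
  proof
    assume "P = e powi (2 * int N - 2)"
    with PD e0 show "D = e\<^sup>2" by simp
  next
    assume "D = e\<^sup>2"
    with PD e0 show "P = e powi (2 * int N - 2)" by simp
  qed
  finally show ?thesis
    by (simp only: vieta[unfolded R_def] D_def R_def)
qed

lemma inversion_criterion_if_rsquarefree:
  fixes f :: "'a::field poly"
  assumes "poly.coeff f 0 \<noteq> 0" "rsquarefree (ac_poly f)"
  shows "inversion_criterion f"
  unfolding inversion_criterion_iff_prod_roots[OF assms(1)]
proof (rule prod.cong)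
  fix r assume "r \<in> {r. poly (ac_poly f) r = 0}"
  have "ac_mult f r = 0 \<or> ac_mult f r = 1"
    using assms(2) by (auto simp: rsquarefree_def)
  thus "r ^ (2 * (ac_mult f r)\<^sup>2) = r ^ (2 * ac_mult f r)"
    by auto
qed simp

text \<open>
  Both sides of the root-by-root form are products of powers of the roots whose exponents depend
  only on the multiplicities. Such products are multiplicative over the disjoint root sets of coprime
  factors.
\<close>
lemma inversion_criterion_mult_coprime:
  fixes g h :: "'a::field poly"
  assumes "coprime g h" "inversion_criterion g" "inversion_criterion h"
  shows "inversion_criterion (g * h)"
proof -
  have g0: "poly.coeff g 0 \<noteq> 0" and h0: "poly.coeff h 0 \<noteq> 0"
    using assms(2,3) by (auto simp: inversion_criterion_def)
  hence gh0: "poly.coeff (g * h) 0 \<noteq> 0" by (simp add: coeff_mult)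
  have nz: "g \<noteq> 0" "h \<noteq> 0" using g0 h0 by auto
  let ?R = "\<lambda>p. {r. poly (ac_poly p) r = 0}"
  have fin: "finite (?R g)" "finite (?R h)"
    using nz by (auto intro: poly_roots_finite)
  have disj: "?R g \<inter> ?R h = {}"
    using coprime_no_common_ac_root[OF assms(1)] by auto
  have mult: "ac_mult (g * h) r = ac_mult g r + ac_mult h r" for r
    using nz by (simp add: ac_poly_mult order_mult)
  have mult_g: "ac_mult (g * h) r = ac_mult g r" if "r \<in> ?R g" for r
    using that coprime_no_common_ac_root[OF assms(1)] by (simp add: mult order_0I)
  have mult_h: "ac_mult (g * h) r = ac_mult h r" if "r \<in> ?R h" for r
    using that coprime_no_common_ac_root[OF assms(1)] by (auto simp: mult intro: order_0I)
  have roots: "?R (g * h) = ?R g \<union> ?R h"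
    by (auto simp: ac_poly_mult)
  have split: "(\<Prod>r\<in>?R (g * h). r ^ k (ac_mult (g * h) r)) =
      (\<Prod>r\<in>?R g. r ^ k (ac_mult g r)) * (\<Prod>r\<in>?R h. r ^ k (ac_mult h r))" for k
    unfolding roots prod.union_disjoint[OF fin disj]
    by (intro arg_cong2[where f = "(*)"] prod.cong) (simp_all only: mult_g mult_h)
  have eq_g: "(\<Prod>r\<in>?R g. r ^ (2 * (ac_mult g r)\<^sup>2)) = (\<Prod>r\<in>?R g. r ^ (2 * ac_mult g r))"
    using inversion_criterion_iff_prod_roots[OF g0] assms(2) by (rule iffD1)
  have eq_h: "(\<Prod>r\<in>?R h. r ^ (2 * (ac_mult h r)\<^sup>2)) = (\<Prod>r\<in>?R h. r ^ (2 * ac_mult h r))"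
    using inversion_criterion_iff_prod_roots[OF h0] assms(3) by (rule iffD1)
  show ?thesis
    by (rule iffD2[OF inversion_criterion_iff_prod_roots[OF gh0]],
        rule trans[OF split[of "\<lambda>m. 2 * m\<^sup>2"]],
        rule trans[OF arg_cong2[OF eq_g eq_h, of "(*)"]],
        rule split[of "\<lambda>m. 2 * m", symmetric])
qed

section \<open>The tolerant of the reciprocal polynomial\<close>

text \<open>
  The inverses of an enumeration of the roots of \<open>f\<close> enumerate the roots of its reciprocal, so the
  products in the two tolerants and in the criterion are taken over the same pairs of indices.
\<close>
lemma tol_reflect_poly_if_inversion_criterion:
  fixes f :: "'a::field poly"
  assumes crit: "inversion_criterion f"
  shows "tol (reflect_poly f) = tol f"
proof -
  have f0: "poly.coeff f 0 \<noteq> 0" using crit by (simp add: inversion_criterion_def)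
  hence nz: "f \<noteq> 0" by auto
  define rs where "rs = ac_roots f"
  note rs = ac_roots[OF nz, folded rs_def]
  define I where "I = {(i, j). i < j \<and> j < length rs}"
  define E where "E i j = 2 * ac_mult f (rs ! i) * ac_mult f (rs ! j)" for i j
  define k where "k = 2 * int (Polynomial.degree f) - 2"
  define a where "a = to_ac (Polynomial.lead_coeff f)"
  define b where "b = to_ac (poly.coeff f 0)"
  have ab: "a \<noteq> 0" "b \<noteq> 0" using f0 nz by (auto simp: a_def b_def)
  have rs_nz: "rs ! i \<noteq> 0" if "i < length rs" for i
    using nonzero_if_ac_root[OF f0] nth_mem[OF that] rs(2) by auto

  have refl_nz: "reflect_poly f \<noteq> 0" using nz by simp
  have set_inv: "set (map inverse rs) = {r. poly (ac_poly (reflect_poly f)) r = 0}"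
    using roots_reflect_poly[of "ac_poly f"] f0
    by (simp only: set_map rs(2) ac_poly_reflect_poly) (simp add: coeff_map_poly)
  have dist_inv: "distinct (map inverse rs)"
    using rs(1) by (simp add: distinct_map inj_on_def)
  have "tol (reflect_poly f) =
      to_ac (Polynomial.lead_coeff (reflect_poly f)) powi
        (2 * int (Polynomial.degree (reflect_poly f)) - 2) *
      (\<Prod>(i, j) \<in> {(i, j). i < j \<and> j < length (map inverse rs)}.
        (map inverse rs ! i - map inverse rs ! j) ^
          (2 * ac_mult (reflect_poly f) (map inverse rs ! i) *
            ac_mult (reflect_poly f) (map inverse rs ! j)))"
    by (rule tol_eq[OF refl_nz dist_inv set_inv])
  also have "\<dots> = b powi k * (\<Prod>(i, j)\<in>I. (inverse (rs ! i) - inverse (rs ! j)) ^ E i j)"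
  proof -
    have "ac_mult (reflect_poly f) (inverse (rs ! i)) = ac_mult f (rs ! i)"
      if "i < length rs" for i
      using order_reflect_poly[of "ac_poly f", OF _ rs_nz[OF that]] nz
      by (simp add: ac_poly_reflect_poly)
    hence "(\<Prod>(i, j) \<in> {(i, j). i < j \<and> j < length (map inverse rs)}.
        (map inverse rs ! i - map inverse rs ! j) ^
          (2 * ac_mult (reflect_poly f) (map inverse rs ! i) *
            ac_mult (reflect_poly f) (map inverse rs ! j))) =
        (\<Prod>(i, j)\<in>I. (inverse (rs ! i) - inverse (rs ! j)) ^ E i j)"
      unfolding I_def E_def by (intro prod.cong) auto
    thus ?thesis
      using f0 by (simp add: b_def k_def coeff_reflect_poly)
  qed
  also have "(\<Prod>(i, j)\<in>I. (inverse (rs ! i) - inverse (rs ! j)) ^ E i j) =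
      (\<Prod>(i, j)\<in>I. (rs ! i - rs ! j) ^ E i j) / (\<Prod>(i, j)\<in>I. (rs ! i * rs ! j) ^ E i j)"
  proof -
    have "(inverse (rs ! i) - inverse (rs ! j)) ^ E i j =
        (rs ! i - rs ! j) ^ E i j / (rs ! i * rs ! j) ^ E i j" if "(i, j) \<in> I" for i j
    proof -
      have "rs ! i \<noteq> 0" "rs ! j \<noteq> 0" using that rs_nz by (auto simp: I_def)
      hence "inverse (rs ! i) - inverse (rs ! j) = - ((rs ! i - rs ! j) / (rs ! i * rs ! j))"
        by (simp add: field_simps)
      moreover have "even (E i j)" by (simp add: E_def)
      ultimately show ?thesis by (simp only: power_minus_even power_divide)
    qed
    thus ?thesis
      unfolding prod_dividef[symmetric] by (intro prod.cong) auto
  qed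
  also have "(\<Prod>(i, j)\<in>I. (rs ! i * rs ! j) ^ E i j) = (b / a) powi k"
    using inversion_criterion_iff[OF nz rs] crit
    by (simp add: I_def E_def k_def a_def b_def)
  also have "b powi k * ((\<Prod>(i, j)\<in>I. (rs ! i - rs ! j) ^ E i j) / (b / a) powi k) =
      a powi k * (\<Prod>(i, j)\<in>I. (rs ! i - rs ! j) ^ E i j)"
    using ab by (simp add: power_int_divide_distrib)
  also have "\<dots> = tol f"
    using tol_eq[OF nz rs] by (simp add: a_def k_def I_def E_def)
  finally show ?thesis .
qed

theorem theorem2p15:
  fixes f :: "'a::field poly"
  assumes "poly f 0 \<noteq> 0"
    and "rsquarefree (map_poly to_ac f) \<or>
      (\<exists>g h. f = g * h \<and> coprime g h \<and> inversion_criterion g \<and> inversion_criterion h)"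
  shows "tol f = tol (reflect_poly f)"
proof -
  have "inversion_criterion f"
    using assms(2)
  proof (elim disjE exE conjE)
    assume "rsquarefree (map_poly to_ac f)"
    with assms(1) show ?thesis
      by (simp add: inversion_criterion_if_rsquarefree poly_0_coeff_0)
  next
    fix g h assume "f = g * h" "coprime g h" "inversion_criterion g" "inversion_criterion h"
    thus ?thesis by (simp add: inversion_criterion_mult_coprime)
  qed
  thus ?thesis by (simp add: tol_reflect_poly_if_inversion_criterion)
qed

end
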